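(* Let $(V,* )$ be a finite travel groupoid with $|V|>1$. Then the following statements are equivalent: (1) $(V,* )$ is on a star graph (i.e. its associated graph $G_V$ is a star graph); (2) $(V,* )$ has a left unit $e\in V$ (that is, $e*v=v$ for all $v\in V$), and for all pairwise distinct $u,v,w\in V$, if $v*w=w$, then exactly one of $v*u=u$ and $w*u=u$ holds.
   Context: A groupoid $(V,* )$ is a nonempty set $V$ with a binary operation $*:V\times V\to V$. It is a travel groupoid if (t1) $(u*v)*u=u$ for all $u,v\in V$, and (t2) for all $u,v\in V$, if $(u*v)*v=u$ then $u=v$. The associated graph $G_V$ of a travel groupoid has vertex set $V$ and edge set $\{\{u,v\} : u,v\in V,\ u\neq u*v=v\}$; $(V,* )$ is said to be on a graph $G$ if $G=G_V$. Graphs are finite, undirected, with no multiple edges or loops. A star graph is a complete bipartite graph $K_{1,n}$ with $n\ge 1$: one central vertex adjacent to all the other $n$ vertices, and no other edges. *)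

theory Defs
  imports "Graph_Theory.Kuratowski"
begin

locale groupoid =
  fixes V :: "'a set" and opr :: "'a \<Rightarrow> 'a \<Rightarrow> 'a" (infixl "\<star>" 70)
  assumes nonempty: "V \<noteq> {}"
    and closed: "\<lbrakk>u \<in> V; v \<in> V\<rbrakk> \<Longrightarrow> u \<star> v \<in> V"

locale travel_groupoid = groupoid +
  assumes t1: "\<lbrakk>u \<in> V; v \<in> V\<rbrakk> \<Longrightarrow> (u \<star> v) \<star> u = u"
    and t2: "\<lbrakk>u \<in> V; v \<in> V; (u \<star> v) \<star> v = u\<rbrakk> \<Longrightarrow> u = v"

definition assoc_edges :: "'a set \<Rightarrow> ('a \<Rightarrow> 'a \<Rightarrow> 'a) \<Rightarrow> 'a set set" where
  "assoc_edges V opr = {{u, v} | u v. u \<in> V \<and> v \<in> V \<and> u \<noteq> opr u v \<and> opr u v = v}"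

text \<open>
  An undirected graph is represented, as in \<^theory>\<open>Graph_Theory.Digraph\<close>, by a symmetric
  digraph: the edge \<open>{u, v}\<close> becomes the two arcs \<open>(u, v)\<close> and \<open>(v, u)\<close>.
  The locale \<^locale>\<open>pair_graph\<close> is that of finite symmetric loop-free graphs.
\<close>

definition assoc_graph :: "'a set \<Rightarrow> ('a \<Rightarrow> 'a \<Rightarrow> 'a) \<Rightarrow> 'a pair_pre_digraph" where
  "assoc_graph V opr = \<lparr> pverts = V, parcs = {(u, v). {u, v} \<in> assoc_edges V opr} \<rparr>"

definition on_graph :: "'a set \<Rightarrow> ('a \<Rightarrow> 'a \<Rightarrow> 'a) \<Rightarrow> 'a pair_pre_digraph \<Rightarrow> bool" where
  "on_graph V opr G \<longleftrightarrow> pair_graph G \<and> G = assoc_graph V opr"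

definition star_graph :: "'a pair_pre_digraph \<Rightarrow> bool" where
  "star_graph G \<longleftrightarrow> (\<exists>n\<ge>1. K\<^bsub>1,n\<^esub> (with_proj G))"

definition left_unit :: "'a set \<Rightarrow> ('a \<Rightarrow> 'a \<Rightarrow> 'a) \<Rightarrow> 'a \<Rightarrow> bool" where
  "left_unit V opr e \<longleftrightarrow> e \<in> V \<and> (\<forall>v\<in>V. opr e v = v)"

end

theory Submission
  imports Defs
begin

text \<open>
  Idempotency makes adjacency of distinct \<open>u\<close>, \<open>v\<close> the same as \<open>u \<star> v = v\<close>, which is symmetric by (t1).
  Hence a left unit is exactly a vertex adjacent to all others. If \<open>e\<close> is one and \<open>v\<close>, \<open>w\<close> are
  distinct from \<open>e\<close> and adjacent, then \<open>e\<close>, \<open>v\<close>, \<open>w\<close> form a triangle, against (2);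
  conversely, in a star with centre \<open>e\<close> every edge contains \<open>e\<close>, and a third vertex is adjacent to
  \<open>e\<close> but not to the other end.
\<close>

context travel_groupoid
begin

text \<open>By (t1), \<open>(u \<star> u) \<star> u = u\<close>; multiplying by \<open>u\<close> on
  the right turns this into the premise of (t2) for the pair \<open>u \<star> u\<close>,
  \<open>u\<close>.\<close>

lemma idem: "u \<star> u = u" if "u \<in> V"
proof -
  have "((u \<star> u) \<star> u) \<star> u = u \<star> u"
    using that by (simp add: t1)
  with that show ?thesis
    using t2 closed by blast
qed

lemma adj_sym: "v \<star> u = u" if "u \<in> V" "v \<in> V" "u \<star> v = v"
  using t1[OF that(1,2)] that(3) by simp

text \<open>An edge is an unordered pair, so its membership yields the product condition in only one
  of the two orders; \<open>adj_sym\<close> gives the other.\<close>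

lemma arc_iff:
  "(u, v) \<in> parcs (assoc_graph V (\<star>)) \<longleftrightarrow> u \<in> V \<and> v \<in> V \<and> u \<noteq> v \<and> u \<star> v = v"
  unfolding assoc_graph_def assoc_edges_def
  by (auto simp: doubleton_eq_iff dest: adj_sym) metis

lemma star_graph_assoc_graph_iff:
  assumes "finite V" and "card V > 1"
  shows "star_graph (assoc_graph V (\<star>)) \<longleftrightarrow>
    (\<exists>e. left_unit V (\<star>) e \<and> (\<forall>v\<in>V. \<forall>w\<in>V. v \<noteq> w \<longrightarrow> v \<star> w = w \<longrightarrow> v = e \<or> w = e))"
    (is "?star \<longleftrightarrow> ?centre")
proof
  assume ?star
  then obtain A B where AB: "V = A \<union> B" "A \<inter> B = {}" "card A = 1"
      "parcs (assoc_graph V (\<star>)) = A \<times> B \<union> B \<times> A"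
    by (auto simp: star_graph_def complete_bipartite_digraph_pair_def assoc_graph_def)
  then obtain e where A: "A = {e}"
    by (auto simp: card_1_singleton_iff)
  have edges: "u \<in> V \<and> v \<in> V \<and> u \<noteq> v \<and> u \<star> v = v \<longleftrightarrow> u = e \<and> v \<in> B \<or> u \<in> B \<and> v = e" for u v
    using arc_iff[of u v] AB(4) A by auto
  \<comment> \<open>Arcs settle only \<open>v \<noteq> e\<close>, as there are no loops; the case
    \<open>v = e\<close> is idempotency.\<close>
  have "e \<star> v = v" if "v \<in> V" for v
    using that AB(1) A edges[of e v] idem by (cases "v = e") auto
  then have "left_unit V (\<star>) e"
    using AB(1) A by (simp add: left_unit_def)
  then show ?centre
    using edges by blast
next
  assume ?centre
  then obtain e where e: "e \<in> V" "\<And>v. v \<in> V \<Longrightarrow> e \<star> v = v"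
      "\<And>v w. \<lbrakk>v \<in> V; w \<in> V; v \<noteq> w; v \<star> w = w\<rbrakk> \<Longrightarrow> v = e \<or> w = e"
    by (auto simp: left_unit_def)
  have "(u, v) \<in> parcs (assoc_graph V (\<star>)) \<longleftrightarrow> (u, v) \<in> {e} \<times> (V - {e}) \<union> (V - {e}) \<times> {e}" for u v
    unfolding arc_iff using e adj_sym by auto
  then have arcs: "parcs (assoc_graph V (\<star>)) = {e} \<times> (V - {e}) \<union> (V - {e}) \<times> {e}"
    by (intro set_eqI) (metis surj_pair)
  have "K\<^bsub>1,card V - 1\<^esub> (with_proj (assoc_graph V (\<star>)))"
    unfolding complete_bipartite_digraph_pair_def arcs
    using assms(1) e(1)
    by (intro conjI exI[of _ "{e}"] exI[of _ "V - {e}"]) (auto simp: assoc_graph_def)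
  \<comment> \<open>The number of leaves is at least 1 because \<open>card V > 1\<close>.\<close>
  then show ?star
    using assms(2) unfolding star_graph_def by (intro exI[of _ "card V - 1"]) simp
qed

end

theorem theorem4p7:
  fixes V :: "'a set" and opr :: "'a \<Rightarrow> 'a \<Rightarrow> 'a" (infixl "\<star>" 70)
  assumes "travel_groupoid V (\<star>)"
    and "finite V"
    and "card V > 1"
  shows "(\<exists>G. star_graph G \<and> on_graph V (\<star>) G) \<longleftrightarrow>
    (\<exists>e. left_unit V (\<star>) e) \<and>
    (\<forall>u\<in>V. \<forall>v\<in>V. \<forall>w\<in>V. u \<noteq> v \<longrightarrow> u \<noteq> w \<longrightarrow> v \<noteq> w \<longrightarrow> v \<star> w = w \<longrightarrow>
      (v \<star> u = u \<and> w \<star> u \<noteq> u) \<or> (v \<star> u \<noteq> u \<and> w \<star> u = u))"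
    (is "?on_star \<longleftrightarrow> ?unit \<and> ?one")
proof -
  interpret travel_groupoid V "(\<star>)"
    by fact
  \<comment> \<open>\<open>on_graph\<close> forces \<open>G\<close> to be the associated graph, and
    a complete bipartite digraph is always a \<open>pair_graph\<close>.\<close>
  have "?on_star \<longleftrightarrow> star_graph (assoc_graph V (\<star>))"
    using pair_graphI_complete_bipartite by (auto simp: on_graph_def star_graph_def)
  also have "\<dots> \<longleftrightarrow>
      (\<exists>e. left_unit V (\<star>) e \<and> (\<forall>v\<in>V. \<forall>w\<in>V. v \<noteq> w \<longrightarrow> v \<star> w = w \<longrightarrow> v = e \<or> w = e))"
    using assms(2,3) by (rule star_graph_assoc_graph_iff)
  also have "\<dots> \<longleftrightarrow> ?unit \<and> ?one"
  proof
    assume "\<exists>e. left_unit V (\<star>) e \<and> (\<forall>v\<in>V. \<forall>w\<in>V. v \<noteq> w \<longrightarrow> v \<star> w = w \<longrightarrow> v = e \<or> w = e)"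
    then obtain e where e: "left_unit V (\<star>) e"
        "\<And>v w. \<lbrakk>v \<in> V; w \<in> V; v \<noteq> w; v \<star> w = w\<rbrakk> \<Longrightarrow> v = e \<or> w = e"
      by blast
    have ?one
      using e unfolding left_unit_def by metis
    with e(1) show "?unit \<and> ?one"
      by blast
  next
    assume *: "?unit \<and> ?one"
    then obtain e where e: "left_unit V (\<star>) e"
      by blast
    have "v = e \<or> w = e" if "v \<in> V" "w \<in> V" "v \<noteq> w" "v \<star> w = w" for v w
    proof (rule ccontr)
      assume "\<not> (v = e \<or> w = e)"
      \<comment> \<open>Taking \<open>u = e\<close> in \<open>?one\<close>, both alternatives hold
        at once, so not exactly one.\<close>
      moreover have "v \<star> e = e" "w \<star> e = e"
        using e that adj_sym by (auto simp: left_unit_def)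
      ultimately show False
        using * e that unfolding left_unit_def by metis
    qed
    with e show "\<exists>e. left_unit V (\<star>) e \<and> (\<forall>v\<in>V. \<forall>w\<in>V. v \<noteq> w \<longrightarrow> v \<star> w = w \<longrightarrow> v = e \<or> w = e)"
      by blast
  qed
  finally show ?thesis .
qed

end
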